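(* For $z\in\mathbb C$ and real $k$ let $J(z,k)=\int_{-\pi/2}^{\pi/2}e^{2zt}\cos^{2k-2}t\,dt$. Then for $k\ge2$, the function $z\mapsto J(z,k)$ has no zeros in the strip $\{z\in\mathbb C:|\operatorname{Im}z|<k\}$. *)

theory Defs
  imports "HOL-Analysis.Analysis"
begin

text \<open>
  On the closed interval the base \<open>cos t\<close> is nonnegative and vanishes only at the endpoints,
  so the real power \<open>powr\<close> gives the usual value there apart from a null set
  (\<open>0 powr a = 0\<close> for every \<open>a\<close>). The integral converges exactly for \<open>k > 1/2\<close>; otherwise
  \<open>J z k\<close> takes the library's default value \<open>0\<close>.
\<close>
definition J :: "complex \<Rightarrow> real \<Rightarrow> complex" where
  "J z k = integral {- pi / 2 .. pi / 2}
             (\<lambda>t::real. exp (2 * z * of_real t) * of_real (cos t powr (2 * k - 2)))"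

end

theory Submission
  imports Defs
begin

text \<open>
  For \<open>k > 1\<close>, integration by parts gives the recursion
  \<open>4 (z\<^sup>2 + k\<^sup>2) J z (k + 1) = 2 k (2 k - 1) J z k\<close> (lemma \<open>J_recursion\<close>).
  The zeros \<open>\<plusminus> \<i> k\<close> of the factor \<open>z\<^sup>2 + k\<^sup>2\<close> lie outside the strip \<open>\<bar>Im z\<bar> < k\<close>, so a zero \<open>z\<close> of
  \<open>J \<cdot> k\<close> in this strip is also a zero of \<open>J \<cdot> (k + 1)\<close>, hence of \<open>J \<cdot> (k + n)\<close> for every \<open>n\<close>.

  This is impossible because the weight \<open>cos t powr (2 * k - 2)\<close> concentrates at \<open>t = 0\<close> as \<open>k\<close>
  grows. Quantitatively, \<open>norm (exp (2 * z * t) - 1) \<le> 1/2 + C * (sin t)\<^sup>2\<close> on the interval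
  (lemma \<open>exp_minus_one_le_sin_squared\<close>), and the recursion at \<open>z = 0\<close> shows that the mean of
  \<open>(sin t)\<^sup>2\<close> with respect to the weight is \<open>1 / (2 * k)\<close>. Hence \<open>J z k\<close> differs from the total mass
  of the weight by at most the fraction \<open>1/2 + C / (2 * k)\<close> of that mass, and cannot vanish for
  large \<open>k\<close> (lemma \<open>J_eventually_nonzero\<close>).
\<close>

section \<open>The recursion in \<open>k\<close>\<close>

lemma continuous_on_cos_powr:
  assumes "a > 0"
  shows "continuous_on {- pi / 2 .. pi / 2} (\<lambda>t::real. cos t powr a)"
  using assms by (intro continuous_on_powr' continuous_intros) (auto intro: cos_ge_zero)

lemma J_integrand_has_integral:
  assumes "k > 1"
  shows "((\<lambda>t::real. exp (2 * z * of_real t) * of_real (cos t powr (2 * k - 2)))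
           has_integral J z k) {- pi / 2 .. pi / 2}"
  unfolding J_def
  by (intro integrable_integral integrable_continuous_interval continuous_on_mult
        continuous_on_of_real continuous_on_cos_powr continuous_intros) (use assms in auto)

lemma J_recursion:
  assumes k: "k > 1"
  shows "4 * (z\<^sup>2 + (of_real k)\<^sup>2) * J z (k + 1) = 2 * of_real k * (2 * of_real k - 1) * J z k"
proof -
  \<comment> \<open>\<open>F\<close> vanishes at both endpoints, and its derivative in the interior is the difference of the
    integrands on the two sides. It need not be differentiable at the endpoints.\<close>
  define F :: "real \<Rightarrow> complex" where
    "F = (\<lambda>t. exp (2 * z * of_real t) * of_real (cos t powr (2 * k - 1))
               * (2 * z * of_real (cos t) + 2 * of_real k * of_real (sin t)))"
  define g :: "real \<Rightarrow> real \<Rightarrow> complex" where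
    "g = (\<lambda>k t. exp (2 * z * of_real t) * of_real (cos t powr (2 * k - 2)))"
  have "((\<lambda>t. 4 * (z\<^sup>2 + (of_real k)\<^sup>2) * g (k + 1) t
            - 2 * of_real k * (2 * of_real k - 1) * g k t)
          has_integral (F (pi / 2) - F (- pi / 2))) {- pi / 2 .. pi / 2}"
  proof (rule fundamental_theorem_of_calculus_interior)
    show "- pi / 2 \<le> pi / 2" by simp
    show "continuous_on {- pi / 2 .. pi / 2} F"
      unfolding F_def
      by (intro continuous_on_mult continuous_on_of_real continuous_on_cos_powr continuous_intros)
        (use k in auto)
  next
    fix t assume t: "t \<in> {- pi / 2 <..< pi / 2}"
    then have c: "cos t > 0" by (intro cos_gt_zero_pi) auto
    define E P C S K where
      "E = exp (2 * z * of_real t)" and "P = complex_of_real (cos t powr (2 * k - 2))"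
      and "C = complex_of_real (cos t)" and "S = complex_of_real (sin t)"
      and "K = complex_of_real k"
    have CS: "S * S = 1 - C * C"
      unfolding C_def S_def of_real_mult[symmetric]
      by (simp add: sin_squared_eq flip: power2_eq_square)
    have "cos t powr (2 * k - 1) = cos t powr (2 * k - 2) * cos t"
      using c powr_add[of "cos t" "2 * k - 2" 1] by (simp add: algebra_simps)
    then have PC: "complex_of_real (cos t powr (2 * k - 1)) = P * C"
      by (simp add: P_def C_def)
    have p1: "cos t powr (2 * (k + 1) - 2) = cos t powr (2 * k - 2) * cos t * cos t"
      using c powr_add[of "cos t" "2 * k - 2" 2]
      by (simp add: algebra_simps power2_eq_square)
    have dE: "((\<lambda>t. exp (2 * z * of_real t)) has_vector_derivative 2 * z * E) (at t)"
      unfolding E_def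
      by (rule has_vector_derivative_eq_rhs, rule field_vector_diff_chain_at[unfolded o_def,
            where f = "\<lambda>t. 2 * z * of_real t" and g = exp and f' = "2 * z"])
         (auto intro!: derivative_eq_intros)
    have "((\<lambda>t. cos t powr (2 * k - 1)) has_real_derivative
             (2 * k - 1) * cos t powr (2 * k - 2) * - sin t) (at t)"
      using c by (auto intro!: derivative_eq_intros simp: algebra_simps)
    then have dP: "((\<lambda>t. complex_of_real (cos t powr (2 * k - 1))) has_vector_derivative
                     - (2 * K - 1) * P * S) (at t)"
      by (rule has_vector_derivative_eq_rhs[OF has_vector_derivative_of_real])
         (simp add: K_def P_def S_def algebra_simps)
    have dC: "((\<lambda>t. complex_of_real (cos t)) has_vector_derivative - S) (at t)"
      by (rule has_vector_derivative_eq_rhs[OF has_vector_derivative_of_real[OF DERIV_cos]])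
         (simp add: S_def)
    have dS: "((\<lambda>t. complex_of_real (sin t)) has_vector_derivative C) (at t)"
      by (rule has_vector_derivative_eq_rhs[OF has_vector_derivative_of_real[OF DERIV_sin]])
         (simp add: C_def)
    have "(F has_vector_derivative
           ((2 * z * E * (P * C) + E * (- (2 * K - 1) * P * S)) * (2 * z * C + 2 * K * S)
            + E * (P * C) * (2 * z * - S + 2 * K * C))) (at t)"
      (is "(F has_vector_derivative ?D) (at t)")
      unfolding F_def
      by (rule has_vector_derivative_eq_rhs[OF has_vector_derivative_mult[OF
            has_vector_derivative_mult[OF dE dP]
            has_vector_derivative_add[OF has_vector_derivative_mult_right[OF dC]
              has_vector_derivative_mult_right[OF dS]]]])
         (unfold PC E_def[symmetric] C_def[symmetric] S_def[symmetric] K_def[symmetric],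
          simp add: algebra_simps)
    moreover have "?D = E * P * (4 * z\<^sup>2 * (C * C) + 2 * K * (C * C) - 2 * K * (2 * K - 1) * (S * S))"
      by (simp add: algebra_simps power2_eq_square)
    moreover have "E * P * (4 * z\<^sup>2 * (C * C) + 2 * K * (C * C) - 2 * K * (2 * K - 1) * (S * S))
            = 4 * (z\<^sup>2 + K\<^sup>2) * (E * (P * C * C)) - 2 * K * (2 * K - 1) * (E * P)"
      unfolding CS by (simp add: algebra_simps power2_eq_square)
    ultimately show "(F has_vector_derivative 4 * (z\<^sup>2 + (of_real k)\<^sup>2) * g (k + 1) t
            - 2 * of_real k * (2 * of_real k - 1) * g k t) (at t)"
      unfolding g_def p1 by (simp add: E_def P_def C_def K_def)
  qed
  moreover have "F (pi / 2) - F (- pi / 2) = 0"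
    by (simp add: F_def)
  ultimately have "((\<lambda>t. 4 * (z\<^sup>2 + (of_real k)\<^sup>2) * g (k + 1) t
            - 2 * of_real k * (2 * of_real k - 1) * g k t) has_integral 0) {- pi / 2 .. pi / 2}"
    by (simp only:)
  moreover have "((\<lambda>t. 4 * (z\<^sup>2 + (of_real k)\<^sup>2) * g (k + 1) t
            - 2 * of_real k * (2 * of_real k - 1) * g k t)
          has_integral (4 * (z\<^sup>2 + (of_real k)\<^sup>2) * J z (k + 1)
            - 2 * of_real k * (2 * of_real k - 1) * J z k)) {- pi / 2 .. pi / 2}"
    unfolding g_def
    by (intro has_integral_diff has_integral_mult_right J_integrand_has_integral) (use k in auto)
  ultimately have "0 = 4 * (z\<^sup>2 + (of_real k)\<^sup>2) * J z (k + 1)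
            - 2 * of_real k * (2 * of_real k - 1) * J z k"
    by (rule has_integral_unique)
  then show ?thesis by simp
qed

section \<open>Concentration of the weight\<close>

text \<open>The total mass of the weight on the interval of integration.\<close>
definition cos_mass :: "real \<Rightarrow> real" where
  "cos_mass k = integral {- pi / 2 .. pi / 2} (\<lambda>t. cos t powr (2 * k - 2))"

lemma cos_powr_has_integral:
  assumes "k > 1"
  shows "((\<lambda>t. cos t powr (2 * k - 2)) has_integral cos_mass k) {- pi / 2 .. pi / 2}"
  unfolding cos_mass_def
  by (intro integrable_integral integrable_continuous_interval continuous_on_cos_powr)
    (use assms in auto)

lemma J_zero_left:
  assumes "k > 1"
  shows "J 0 k = of_real (cos_mass k)"
  using has_integral_unique[OF J_integrand_has_integral[OF assms, of 0]]
    has_integral_of_real[OF cos_powr_has_integral[OF assms], where 'b = complex]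
  by simp

lemma cos_mass_pos:
  assumes k: "k > 1"
  shows "cos_mass k > 0"
proof -
  have "cos_mass k \<noteq> 0"
  proof
    assume "cos_mass k = 0"
    then have "\<forall>t\<in>{- pi / 2 .. pi / 2}. cos t powr (2 * k - 2) = 0"
      unfolding cos_mass_def
      by (subst (asm) integral_eq_0_iff) (use k continuous_on_cos_powr[of "2 * k - 2"] in auto)
    from this[rule_format, of 0] show False by simp
  qed
  moreover have "cos_mass k \<ge> 0"
    unfolding cos_mass_def by (rule integral_nonneg)
      (use cos_powr_has_integral[OF k] in auto)
  ultimately show ?thesis by simp
qed

text \<open>
  Since \<open>(sin t)\<^sup>2 = 1 - (cos t)\<^sup>2\<close>, this integral is \<open>cos_mass k - cos_mass (k + 1)\<close>, which the
  recursion at \<open>z = 0\<close> evaluates.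
\<close>
lemma cos_sin_squared_has_integral:
  assumes k: "k > 1"
  shows "((\<lambda>t. (sin t)\<^sup>2 * cos t powr (2 * k - 2)) has_integral cos_mass k / (2 * k))
           {- pi / 2 .. pi / 2}"
proof -
  have "complex_of_real (4 * k\<^sup>2 * cos_mass (k + 1)) = of_real (2 * k * (2 * k - 1) * cos_mass k)"
    using J_recursion[OF k, of 0] J_zero_left[of k] J_zero_left[of "k + 1"] k by simp
  then have "2 * k * (2 * k * cos_mass (k + 1)) = 2 * k * ((2 * k - 1) * cos_mass k)"
    unfolding of_real_eq_iff by (simp add: power2_eq_square)
  then have "2 * k * cos_mass (k + 1) = (2 * k - 1) * cos_mass k"
    using k by (subst (asm) mult_left_cancel) auto
  then have eq: "cos_mass k - cos_mass (k + 1) = cos_mass k / (2 * k)"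
    using k by (simp add: field_simps)
  show ?thesis
    unfolding eq[symmetric]
  proof (rule has_integral_eq[rotated])
    show "((\<lambda>t. cos t powr (2 * k - 2) - cos t powr (2 * (k + 1) - 2))
            has_integral cos_mass k - cos_mass (k + 1)) {- pi / 2 .. pi / 2}"
      using k by (intro has_integral_diff cos_powr_has_integral) auto
  next
    fix t assume "t \<in> {- pi / 2 .. pi / 2}"
    then have "cos t \<ge> 0" by (intro cos_ge_zero) auto
    then have "cos t powr (2 * (k + 1) - 2) = cos t powr (2 * k - 2) * (cos t)\<^sup>2"
      using powr_add[of "cos t" "2 * k - 2" 2]
      by (cases "cos t = 0") (simp_all add: algebra_simps)
    then show "cos t powr (2 * k - 2) - cos t powr (2 * (k + 1) - 2)
                 = (sin t)\<^sup>2 * cos t powr (2 * k - 2)"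
      by (simp add: sin_squared_eq algebra_simps)
  qed
qed

text \<open>
  The term \<open>1/2\<close> covers a neighbourhood of \<open>t = 0\<close>, by continuity. Away from it, \<open>(sin t)\<^sup>2\<close> is
  bounded below and the left-hand side is bounded.
\<close>
lemma exp_minus_one_le_sin_squared:
  fixes w :: complex
  obtains C where "C \<ge> 0"
    and "\<And>t. t \<in> {- pi / 2 .. pi / 2} \<Longrightarrow> norm (exp (w * of_real t) - 1) \<le> 1 / 2 + C * (sin t)\<^sup>2"
proof -
  let ?f = "\<lambda>t::real. exp (w * of_real t) - 1"
  have cont: "continuous_on S ?f" for S
    by (intro continuous_intros)
  obtain d where d: "d > 0" and near: "\<And>t. \<bar>t\<bar> < d \<Longrightarrow> norm (?f t) < 1 / 2"
    using cont[of UNIV, unfolded continuous_on_iff, rule_format, of 0 "1 / 2"]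
    by (auto simp: dist_norm)
  define e where "e = min d (pi / 2)"
  have e: "0 < e" "e \<le> d" "e \<le> pi / 2"
    using d by (auto simp: e_def)
  have "bounded (?f ` {- pi / 2 .. pi / 2})"
    by (intro compact_imp_bounded compact_continuous_image cont compact_Icc)
  then obtain M where M: "M > 0" "\<And>t. t \<in> {- pi / 2 .. pi / 2} \<Longrightarrow> norm (?f t) \<le> M"
    unfolding bounded_pos by blast
  have se: "sin e > 0"
    using e pi_gt_zero by (intro sin_gt_zero) linarith+
  show ?thesis
  proof
    show "M / (sin e)\<^sup>2 \<ge> 0" using M by simp
  next
    fix t assume t: "t \<in> {- pi / 2 .. pi / 2}"
    show "norm (?f t) \<le> 1 / 2 + M / (sin e)\<^sup>2 * (sin t)\<^sup>2"
    proof (cases "\<bar>t\<bar> < e")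
      case True
      have "0 \<le> M / (sin e)\<^sup>2 * (sin t)\<^sup>2" using M by simp
      then show ?thesis using near[of t] True e by linarith
    next
      case False
      have "sin e \<le> sin \<bar>t\<bar>"
        using False e t by (intro sin_monotone_2pi_le) auto
      then have "(sin e)\<^sup>2 \<le> (sin \<bar>t\<bar>)\<^sup>2"
        using se by (intro power_mono) auto
      also have "(sin \<bar>t\<bar>)\<^sup>2 = (sin t)\<^sup>2"
        by (simp add: abs_if)
      finally have "M * (sin e)\<^sup>2 \<le> M * (sin t)\<^sup>2"
        using M by simp
      then have "M \<le> M / (sin e)\<^sup>2 * (sin t)\<^sup>2"
        using se by (simp add: field_simps)
      then show ?thesis using M(2)[OF t] by linarith
    qed
  qed
qed

lemma J_eventually_nonzero: "\<exists>N. \<forall>k>N. J z k \<noteq> 0"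
proof -
  obtain C where C: "C \<ge> 0" and
    bound: "\<And>t. t \<in> {- pi / 2 .. pi / 2} \<Longrightarrow>
              norm (exp (2 * z * of_real t) - 1) \<le> 1 / 2 + C * (sin t)\<^sup>2"
    using exp_minus_one_le_sin_squared[of "2 * z"] by blast
  \<comment> \<open>For \<open>k > C\<close> the fraction \<open>1/2 + C / (2 * k)\<close> is less than \<open>1\<close>.\<close>
  have "J z k \<noteq> 0" if "k > max 1 C" for k
  proof
    assume J0: "J z k = 0"
    have k: "k > 1" "k > C" using that by auto
    let ?I = "{- pi / 2 .. pi / 2}" and ?p = "\<lambda>t. cos t powr (2 * k - 2)"
    have 1: "((\<lambda>t. exp (2 * z * of_real t) * of_real (?p t) - of_real (?p t))
               has_integral (J z k - of_real (cos_mass k))) ?I"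
      by (intro has_integral_diff J_integrand_has_integral has_integral_of_real
            cos_powr_has_integral k)
    have 2: "((\<lambda>t. 1 / 2 * ?p t + C * ((sin t)\<^sup>2 * ?p t))
               has_integral (1 / 2 * cos_mass k + C * (cos_mass k / (2 * k)))) ?I"
      by (intro has_integral_add has_integral_mult_right cos_powr_has_integral
            cos_sin_squared_has_integral k)
    have 3: "norm (exp (2 * z * of_real t) * of_real (?p t) - of_real (?p t))
            \<le> 1 / 2 * ?p t + C * ((sin t)\<^sup>2 * ?p t)" if "t \<in> ?I" for t
    proof -
      have "norm (exp (2 * z * of_real t) * of_real (?p t) - of_real (?p t))
              = norm ((exp (2 * z * of_real t) - 1) * of_real (?p t))"
        by (simp add: algebra_simps)
      also have "\<dots> = norm (exp (2 * z * of_real t) - 1) * ?p t"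
        by (simp add: norm_mult)
      also have "\<dots> \<le> (1 / 2 + C * (sin t)\<^sup>2) * ?p t"
        by (intro mult_right_mono bound that) auto
      finally show ?thesis by (simp add: algebra_simps)
    qed
    have "norm (J z k - of_real (cos_mass k)) \<le> 1 / 2 * cos_mass k + C * (cos_mass k / (2 * k))"
      using integral_norm_bound_integral[OF has_integral_integrable[OF 1]
          has_integral_integrable[OF 2] 3]
      unfolding integral_unique[OF 1] integral_unique[OF 2] .
    then have "cos_mass k \<le> 1 / 2 * cos_mass k + C * (cos_mass k / (2 * k))"
      using cos_mass_pos[OF k(1)] by (simp add: J0)
    then have "k * cos_mass k \<le> C * cos_mass k"
      using k by (simp add: field_simps)
    then show False
      using cos_mass_pos[OF k(1)] k by simp
  qed
  then show ?thesis by blast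
qed

section \<open>Absence of zeros in the strip\<close>

lemma J_zero_step:
  assumes k: "k > 1" and z: "\<bar>Im z\<bar> < k" and J0: "J z k = 0"
  shows "J z (k + 1) = 0"
proof -
  have "z\<^sup>2 + (of_real k)\<^sup>2 = (z + \<i> * of_real k) * (z - \<i> * of_real k)"
    by (simp add: algebra_simps power2_eq_square)
  moreover have "z + \<i> * of_real k \<noteq> 0" "z - \<i> * of_real k \<noteq> 0"
    using z by (auto simp: complex_eq_iff)
  ultimately show ?thesis
    using J_recursion[OF k, of z] J0 by auto
qed

theorem theorem1p4:
  fixes k :: real
  assumes "k \<ge> 2"
  shows "\<forall>z \<in> {z :: complex. \<bar>Im z\<bar> < k}. J z k \<noteq> 0"
proof (intro ballI notI)
  fix z :: complex
  assume "z \<in> {z. \<bar>Im z\<bar> < k}" and J0: "J z k = 0"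
  then have z: "\<bar>Im z\<bar> < k" by simp
  have zeros: "J z (k + real n) = 0" for n
  proof (induction n)
    case 0
    then show ?case using J0 by simp
  next
    case (Suc n)
    then show ?case
      using J_zero_step[of "k + real n" z] z assms by (simp add: add_ac)
  qed
  obtain N where N: "\<And>k. k > N \<Longrightarrow> J z k \<noteq> 0"
    using J_eventually_nonzero by blast
  obtain n where "real n > N - k"
    using reals_Archimedean2 by blast
  then show False
    using zeros[of n] N[of "k + real n"] by simp
qed

end
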